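(* Let $d$ and $n$ be positive integers and let $i, j \in \{1, \dots, d\}$. Let $U = (u_{ij})$ be a matrix chosen randomly with respect to normalized Haar measure from the unitary group $U(d)$. Then $$\mathbb{E}_{U(d)}\big(|u_{ij}|^{2n}\big) = \frac{n!}{d(d+1)\cdots(d+n-1)} = \binom{d+n-1}{n}^{-1}.$$
   Context: $U(d)$ is the group of $d \times d$ complex unitary matrices, regarded as a probability space under normalized Haar measure $dU$, and $\mathbb{E}_{U(d)}(X) = \int_{U(d)} X\, dU$. $u_{ij}$ denotes the $(i,j)$ entry of $U$. *)

theory Defs
  imports "HOL-Probability.Probability"
begin

definition conj_transpose :: "complex^'n^'m \<Rightarrow> complex^'m^'n" where
  "conj_transpose A = (\<chi> i j. cnj (A $ j $ i))"

text \<open>The group $U(d)$, where $d$ is the cardinality of the index type.\<close>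

definition unitary_group :: "(complex^'d::finite^'d) set" where
  "unitary_group = {U. conj_transpose U ** U = mat 1 \<and> U ** conj_transpose U = mat 1}"

text \<open>
  A Borel probability measure on $U(d)$ (with the subspace topology from the space of
  $d \times d$ complex matrices) that is invariant under left translations. By existence and
  uniqueness of Haar measure there is exactly one such measure. Regularity is automatic, since
  $U(d)$ is a compact metric space, and so is right invariance, since compact groups are
  unimodular.
\<close>

definition normalized_haar_measure :: "(complex^'d::finite^'d) measure \<Rightarrow> bool" where
  "normalized_haar_measure M \<longleftrightarrow>
     prob_space M \<and>
     sets M = sets (restrict_space borel unitary_group) \<and>
     (\<forall>V\<in>unitary_group. \<forall>A\<in>sets M. emeasure M ((\<lambda>U. V ** U) ` A) = emeasure M A)"

end

theory Submission
  imports Defs "HOL-Computational_Algebra.Polynomial"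
begin

text \<open>
  Let $v$ be the $j$-th column of $U$ and $T_n = E(|v_k|^{2n})$. Applying left invariance to
  unitary maps that act only on the coordinates $k \neq l$ gives
  $E(|v_k + x z v_l|^{2n}) = (1 + x^2)^n T_n$ for all real $x$ and $z \in \{1, i\}$.
  Both sides are polynomials in $x$; adding the coefficients of $x^2$ for $z = 1$ and $z = i$
  yields $n\,E(|v_k|^{2n-2} |v_l|^2) = T_n$. Since $v$ is a unit vector, summing over $l$ gives
  $n\,T_{n-1} = (d + n - 1)\,T_n$.
\<close>

section \<open>Unitary matrices acting on two coordinates by an SU(2) block\<close>

definition plane_rotation :: "'d \<Rightarrow> 'd \<Rightarrow> complex \<Rightarrow> complex \<Rightarrow> complex^'d::finite^'d" where
  "plane_rotation k l a b = (\<chi> p q.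
     if p = k then (if q = k then a else if q = l then b else 0)
     else if p = l then (if q = k then - cnj b else if q = l then cnj a else 0)
     else if p = q then 1 else 0)"

lemma plane_rotation_mult_nth:
  assumes "k \<noteq> l"
  shows "(plane_rotation k l a b ** W) $ p $ q =
    (if p = k then a * W $ k $ q + b * W $ l $ q
     else if p = l then cnj a * W $ l $ q - cnj b * W $ k $ q
     else W $ p $ q)"
proof -
  have two: "(\<Sum>r\<in>UNIV. (if r = k then f else if r = l then g else 0) * W $ r $ q)
      = f * W $ k $ q + g * W $ l $ q" for f g
  proof -
    have "(\<Sum>r\<in>UNIV. (if r = k then f else if r = l then g else 0) * W $ r $ q)
        = (\<Sum>r\<in>UNIV. (if r = k then f * W $ k $ q else 0) + (if r = l then g * W $ l $ q else 0))"
      using assms by (intro sum.cong) auto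
    then show ?thesis by (simp add: sum.distrib)
  qed
  have one: "(\<Sum>r\<in>UNIV. (if p = r then 1 else 0) * W $ r $ q) = W $ p $ q"
    by (simp add: if_distrib[of "\<lambda>x. x * _"] cong: if_cong)
  show ?thesis
    unfolding plane_rotation_def matrix_matrix_mult_def
    by (simp add: two one)
qed

lemma conj_transpose_plane_rotation:
  "k \<noteq> l \<Longrightarrow> conj_transpose (plane_rotation k l a b) = plane_rotation k l (cnj a) (- b)"
  by (auto simp: conj_transpose_def plane_rotation_def vec_eq_iff)

lemma plane_rotation_inverse:
  assumes "k \<noteq> l" and "(cmod a)\<^sup>2 + (cmod b)\<^sup>2 = 1"
  shows "plane_rotation k l a b ** plane_rotation k l (cnj a) (- b) = mat 1"
proof -
  have "a * cnj a + b * cnj b = 1"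
    using assms(2) by (metis complex_norm_square of_real_1 of_real_add)
  moreover from this have "cnj a * a + cnj b * b = 1"
    by (simp add: mult.commute)
  ultimately show ?thesis
    using assms(1)
    by (auto simp: vec_eq_iff plane_rotation_mult_nth)
      (auto simp: plane_rotation_def mat_def mult.commute add.commute)
qed

text \<open>The conjugate transpose is again a \<open>plane_rotation\<close>, and its parameters
  \<open>cnj a\<close>, \<open>- b\<close> satisfy the same norm condition. One product computation,
  used once for each pair of parameters, therefore gives both equations of unitarity.\<close>

lemma plane_rotation_unitary:
  assumes "k \<noteq> l" and "(cmod a)\<^sup>2 + (cmod b)\<^sup>2 = 1"
  shows "plane_rotation k l a b \<in> unitary_group"
  using plane_rotation_inverse[OF assms] plane_rotation_inverse[of k l "cnj a" "- b"] assms
  by (simp add: unitary_group_def conj_transpose_plane_rotation)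

section \<open>Products, columns and boundedness of unitary matrices\<close>

lemma conj_transpose_mult:
  "conj_transpose (A ** B) = conj_transpose B ** conj_transpose A"
  by (simp add: conj_transpose_def matrix_matrix_mult_def vec_eq_iff mult.commute)

lemma conj_transpose_conj_transpose [simp]: "conj_transpose (conj_transpose A) = A"
  by (simp add: conj_transpose_def vec_eq_iff)

lemma unitary_mult:
  assumes "U \<in> unitary_group" "V \<in> unitary_group"
  shows "U ** V \<in> unitary_group"
proof -
  have "conj_transpose V ** conj_transpose U ** (U ** V) =
      conj_transpose V ** (conj_transpose U ** U) ** V"
    "U ** V ** (conj_transpose V ** conj_transpose U) =
      U ** (V ** conj_transpose V) ** conj_transpose U"
    by (simp_all only: matrix_mul_assoc)
  with assms show ?thesis
    by (simp add: unitary_group_def conj_transpose_mult)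
qed

lemma unitary_column_norm:
  assumes "U \<in> unitary_group"
  shows "(\<Sum>l\<in>UNIV. (cmod (U $ l $ j))\<^sup>2) = 1"
proof -
  have "(conj_transpose U ** U) $ j $ j = 1"
    using assms by (simp add: unitary_group_def mat_def)
  then have "complex_of_real (\<Sum>l\<in>UNIV. (cmod (U $ l $ j))\<^sup>2) = 1"
    by (simp add: matrix_matrix_mult_def conj_transpose_def complex_norm_square mult.commute
        del: of_real_power)
  then show ?thesis
    using of_real_eq_1_iff by blast
qed

text \<open>Unit columns force every entry to have modulus at most 1. The bound is what later makes
  continuous functions integrable.\<close>

lemma bounded_unitary_group: "bounded (unitary_group :: (complex^'d::finite^'d) set)"
proof -
  have "norm U \<le> (\<Sum>p\<in>(UNIV::'d set). \<Sum>q\<in>(UNIV::'d set). 1)"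
    if "U \<in> unitary_group" for U :: "complex^'d^'d"
  proof -
    have entry: "cmod (U $ p $ q) \<le> 1" for p q
    proof -
      have "(cmod (U $ p $ q))\<^sup>2 \<le> (\<Sum>l\<in>UNIV. (cmod (U $ l $ q))\<^sup>2)"
        by (intro member_le_sum) auto
      then show ?thesis
        using unitary_column_norm[OF that] by (simp add: abs_square_le_1)
    qed
    have "norm U \<le> (\<Sum>p\<in>UNIV. norm (U $ p))"
      by (simp add: norm_vec_def L2_set_le_sum)
    also have "\<dots> \<le> (\<Sum>p\<in>UNIV. \<Sum>q\<in>UNIV. cmod (U $ p $ q))"
      by (intro sum_mono) (simp add: norm_vec_def L2_set_le_sum)
    also have "\<dots> \<le> (\<Sum>p\<in>(UNIV::'d set). \<Sum>q\<in>(UNIV::'d set). 1)"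
      by (intro sum_mono entry)
    finally show ?thesis .
  qed
  then show ?thesis
    by (meson boundedI)
qed

lemma continuous_matrix_mult_left:
  "continuous_on S (\<lambda>U. (V :: complex^'m::finite^'k::finite) ** (U :: complex^'n::finite^'m))"
  unfolding matrix_matrix_mult_def by (intro continuous_intros)

section \<open>Coefficients of powers of a quadratic polynomial\<close>

lemma coeff_trinomial_power:
  fixes a b c :: "'a :: field_char_0"
  shows "coeff ([:a, c, b:] ^ n) 0 = a ^ n"
    and "coeff ([:a, c, b:] ^ n) 1 = of_nat n * a ^ (n - 1) * c"
    and "2 * coeff ([:a, c, b:] ^ n) 2
      = 2 * of_nat n * a ^ (n - 1) * b + of_nat (n * (n - 1)) * a ^ (n - 2) * c\<^sup>2"
proof (induction n)
  case 0
  show "coeff ([:a, c, b:] ^ 0) 0 = a ^ 0"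
    "coeff ([:a, c, b:] ^ 0) 1 = of_nat 0 * a ^ (0 - 1) * c"
    "2 * coeff ([:a, c, b:] ^ 0) 2
      = 2 * of_nat 0 * a ^ (0 - 1) * b + of_nat (0 * (0 - 1)) * a ^ (0 - 2) * c\<^sup>2"
    by simp_all
next
  case (Suc n)
  define p where "p = [:a, c, b:] ^ n"
  note IH = Suc.IH[folded p_def]
  \<comment> \<open>Horner form of the product: each \<open>pCons 0\<close> is a multiplication by
    the variable, so coefficients 0, 1 and 2 can be read off in turn.\<close>
  have step: "[:a, c, b:] ^ Suc n = smult a p + pCons 0 (smult c p + pCons 0 (smult b p))"
    by (simp add: p_def algebra_simps)
  show "coeff ([:a, c, b:] ^ Suc n) 0 = a ^ Suc n"
    unfolding step using IH(1) by simp
  show "coeff ([:a, c, b:] ^ Suc n) 1 = of_nat (Suc n) * a ^ (Suc n - 1) * c"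
    unfolding step using IH(1,2) by (cases n) (simp_all add: algebra_simps)
  \<comment> \<open>Doubling replaces the binomial coefficient n(n-1)/2 by n(n-1) and keeps the
    formula free of division.\<close>
  have "2 * coeff ([:a, c, b:] ^ Suc n) 2
      = a * (2 * coeff p 2) + 2 * (c * coeff p 1) + 2 * (b * coeff p 0)"
    unfolding step by (simp add: numeral_2_eq_2 algebra_simps)
  also have "\<dots> = 2 * of_nat (Suc n) * a ^ (Suc n - 1) * b
      + of_nat (Suc n * (Suc n - 1)) * a ^ (Suc n - 2) * c\<^sup>2"
    \<comment> \<open>The small cases are split off because \<open>n - 1\<close> and
      \<open>n - 2\<close> truncate there; the factors n and n(n-1) in front of these powers then
      vanish.\<close>
    unfolding IH
    by (cases n; cases "n - 1") (simp_all add: algebra_simps power2_eq_square)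
  finally show "2 * coeff ([:a, c, b:] ^ Suc n) 2
      = 2 * of_nat (Suc n) * a ^ (Suc n - 1) * b
        + of_nat (Suc n * (Suc n - 1)) * a ^ (Suc n - 2) * c\<^sup>2" .
qed

text \<open>Each coefficient of a product is a finite sum of products of coefficients, so continuity
  passes through the induction. This allows expectations to be taken coefficient by
  coefficient.\<close>

lemma continuous_coeff_trinomial_power:
  fixes a b c :: "'a::topological_space \<Rightarrow> real"
  assumes "continuous_on S a" "continuous_on S b" "continuous_on S c"
  shows "continuous_on S (\<lambda>x. coeff ([:a x, c x, b x:] ^ n) i)"
proof (induction n arbitrary: i)
  case (Suc n)
  have base: "continuous_on S (\<lambda>x. coeff [:a x, c x, b x:] i)" for i
  proof -
    consider "i = 0" | "i = 1" | "i = 2" | m where "i = Suc (Suc (Suc m))"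
      by (metis One_nat_def Suc_1 not0_implies_Suc)
    then show ?thesis
      using assms by cases (simp_all add: numeral_2_eq_2)
  qed
  show ?case
    unfolding power_Suc coeff_mult by (intro continuous_intros base Suc)
qed simp

section \<open>Integration against Haar measure and its left invariance\<close>

locale haar_unitary =
  fixes M :: "(complex^'d::finite^'d) measure"
  assumes haar: "normalized_haar_measure M"
begin

sublocale prob_space M
  using haar by (simp add: normalized_haar_measure_def)

lemma sets_haar: "sets M = sets (restrict_space borel unitary_group)"
  using haar by (simp add: normalized_haar_measure_def)

lemma space_haar: "space M = unitary_group"
  using sets_eq_imp_space_eq[OF sets_haar] by (simp add: space_restrict_space)

lemma measurable_continuous:
  fixes f :: "complex^'d^'d \<Rightarrow> 'b::real_normed_vector"
  assumes "continuous_on UNIV f"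
  shows "f \<in> borel_measurable M"
proof -
  have "f \<in> borel_measurable borel"
    using assms by (rule borel_measurable_continuous_onI)
  then have "f \<in> measurable (restrict_space borel unitary_group) borel"
    by (rule measurable_restrict_space1)
  then show ?thesis
    using measurable_cong_sets[OF sets_haar refl] by blast
qed

lemma integrable_continuous:
  fixes f :: "complex^'d^'d \<Rightarrow> real"
  assumes "continuous_on UNIV f"
  shows "integrable M f"
proof -
  \<comment> \<open>Passing to the closure turns boundedness into compactness; f is continuous on
    all matrices, hence also there.\<close>
  have "compact (closure (unitary_group :: (complex^'d^'d) set))"
    using bounded_unitary_group by (simp add: compact_closure)
  then have "bounded (f ` closure unitary_group)"
    using assms by (meson compact_continuous_image compact_imp_bounded continuous_on_subset subset_UNIV)
  then obtain B where "\<And>U. U \<in> closure unitary_group \<Longrightarrow> norm (f U) \<le> B"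
    by (auto simp: bounded_iff)
  then have "AE U in M. norm (f U) \<le> B"
    using closure_subset by (intro AE_I2) (auto simp: space_haar)
  then show ?thesis
    using measurable_continuous[OF assms] by (rule integrable_const_bound)
qed

lemma measurable_left_mult:
  assumes "V \<in> unitary_group"
  shows "(\<lambda>U. V ** U) \<in> measurable M M"
proof -
  have "(\<lambda>U. V ** U) \<in> measurable M (restrict_space borel unitary_group)"
    using assms
    by (intro measurable_restrict_space2 measurable_continuous continuous_matrix_mult_left)
      (auto simp: space_haar unitary_mult)
  then show ?thesis
    using measurable_cong_sets[OF refl sets_haar] by blast
qed

text \<open>Invariance is given for images of sets, whereas a push-forward measure uses preimages.
  The two agree because the preimage under V is the image under its inverse
  \<open>conj_transpose V\<close>, which is unitary too.\<close>

lemma distr_left_mult: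
  assumes V: "V \<in> unitary_group"
  shows "distr M M (\<lambda>U. V ** U) = M"
proof (rule measure_eqI)
  fix A assume "A \<in> sets (distr M M (\<lambda>U. V ** U))"
  then have A: "A \<in> sets M" by simp
  then have sub: "A \<subseteq> unitary_group"
    using sets.sets_into_space space_haar by blast
  let ?V = "conj_transpose V"
  have V': "?V \<in> unitary_group" "V ** ?V = mat 1" "?V ** V = mat 1"
    using V by (simp_all add: unitary_group_def)
  have "(\<lambda>U. V ** U) -` A \<inter> space M = (\<lambda>U. ?V ** U) ` A"
  proof (intro equalityI subsetI)
    fix U assume "U \<in> (\<lambda>U. V ** U) -` A \<inter> space M"
    then show "U \<in> (\<lambda>U. ?V ** U) ` A"
      using V' by (intro image_eqI[of _ _ "V ** U"]) (auto simp: matrix_mul_assoc)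
  next
    fix U assume "U \<in> (\<lambda>U. ?V ** U) ` A"
    then show "U \<in> (\<lambda>U. V ** U) -` A \<inter> space M"
      using V' sub by (auto simp: matrix_mul_assoc space_haar intro!: unitary_mult)
  qed
  then have "emeasure (distr M M (\<lambda>U. V ** U)) A = emeasure M ((\<lambda>U. ?V ** U) ` A)"
    using A measurable_left_mult[OF V] by (simp add: emeasure_distr)
  also have "\<dots> = emeasure M A"
    using haar V' A by (simp add: normalized_haar_measure_def)
  finally show "emeasure (distr M M (\<lambda>U. V ** U)) A = emeasure M A" .
qed simp

lemma expectation_left_mult:
  fixes f :: "complex^'d^'d \<Rightarrow> real"
  assumes "V \<in> unitary_group" and "continuous_on UNIV f"
  shows "expectation (\<lambda>U. f (V ** U)) = expectation f"
proof -
  have "expectation f = integral\<^sup>L (distr M M (\<lambda>U. V ** U)) f"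
    by (simp add: distr_left_mult assms)
  also have "\<dots> = expectation (\<lambda>U. f (V ** U))"
    using assms by (intro integral_distr measurable_left_mult measurable_continuous)
  finally show ?thesis by simp
qed

section \<open>Moments of a single entry and their recursion\<close>

definition moment :: "'d \<Rightarrow> 'd \<Rightarrow> nat \<Rightarrow> real" where
  "moment k j n = expectation (\<lambda>U. (cmod (U $ k $ j))\<^sup>2 ^ n)"

text \<open>The coefficient vector (1, x z) has length r = sqrt(1 + x^2). Divided by r it is the
  nonzero part of row k of a plane rotation, so the linear form is r times an entry of a rotated
  matrix, and invariance leaves only the factor r^(2n).\<close>

lemma expectation_linear_form:
  assumes "k \<noteq> l" and "cmod z = 1"
  shows "expectation (\<lambda>U. (cmod (U $ k $ j + of_real x * z * U $ l $ j))\<^sup>2 ^ n)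
    = (1 + x\<^sup>2) ^ n * moment k j n"
proof -
  define r where "r = sqrt (1 + x\<^sup>2)"
  have r: "r > 0" "r\<^sup>2 = 1 + x\<^sup>2"
    by (simp_all add: r_def add_pos_nonneg)
  define a b where "a = complex_of_real (1 / r)" and "b = of_real (x / r) * z"
  have "(cmod a)\<^sup>2 + (cmod b)\<^sup>2 = (1 + x\<^sup>2) / r\<^sup>2"
    using assms
    by (simp add: a_def b_def norm_mult norm_divide power_divide add_divide_distrib)
  also have "\<dots> = 1"
    using r by (metis divide_self less_irrefl power_eq_0_iff)
  finally have V: "plane_rotation k l a b \<in> unitary_group"
    using assms(1) by (intro plane_rotation_unitary)
  have form: "U $ k $ j + of_real x * z * U $ l $ j
      = of_real r * (plane_rotation k l a b ** U) $ k $ j" for U :: "complex^'d^'d"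
    using assms(1) r(1) by (simp add: plane_rotation_mult_nth a_def b_def field_simps)
  have "expectation (\<lambda>U. (cmod (U $ k $ j + of_real x * z * U $ l $ j))\<^sup>2 ^ n)
      = (1 + x\<^sup>2) ^ n
        * expectation (\<lambda>U. (cmod ((plane_rotation k l a b ** U) $ k $ j))\<^sup>2 ^ n)"
    unfolding form by (simp add: norm_mult power_mult_distrib r)
  also have "expectation (\<lambda>U. (cmod ((plane_rotation k l a b ** U) $ k $ j))\<^sup>2 ^ n)
      = moment k j n"
    unfolding moment_def
    by (rule expectation_left_mult[OF V, of "\<lambda>U. (cmod (U $ k $ j))\<^sup>2 ^ n"])
      (intro continuous_intros)
  finally show ?thesis .
qed

text \<open>The quadratic is |u + x z v|^2 as a polynomial in x, where u and v are the entries in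
  rows k and l of column j; its leading coefficient is |v|^2 since |z| = 1. The right-hand side is
  the coefficient of x^2 in (1 + x^2)^n times the moment.\<close>

lemma expectation_coeff_trinomial:
  assumes "k \<noteq> l" and "cmod z = 1"
  shows "expectation (\<lambda>U. coeff ([:(cmod (U $ k $ j))\<^sup>2, 2 * Re (cnj (U $ k $ j) * (z * U $ l $ j)),
      (cmod (U $ l $ j))\<^sup>2:] ^ n) 2) = of_nat n * moment k j n"
proof -
  define p where "p U = [:(cmod (U $ k $ j))\<^sup>2, 2 * Re (cnj (U $ k $ j) * (z * U $ l $ j)),
      (cmod (U $ l $ j))\<^sup>2:]" for U :: "complex^'d^'d"
  have cont: "continuous_on UNIV (\<lambda>U. coeff (p U ^ n) i)" for i
    unfolding p_def by (intro continuous_coeff_trinomial_power continuous_intros)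
  note int = integrable_continuous[OF cont]
  \<comment> \<open>P is the expectation of the random polynomial \<open>p U ^ n\<close>, taken
    coefficientwise; 2n bounds its degree for every U.\<close>
  define P where "P = (\<Sum>i\<le>2 * n. monom (expectation (\<lambda>U. coeff (p U ^ n) i)) i)"
  have "poly P x = poly (smult (moment k j n) ([:1, 0, 1:] ^ n)) x" for x
  proof -
    have eval: "(cmod (U $ k $ j + of_real x * z * U $ l $ j))\<^sup>2 = poly (p U) x"
      for U :: "complex^'d^'d"
    proof -
      have "(cmod (z * U $ l $ j))\<^sup>2 = (cmod (U $ l $ j))\<^sup>2"
        using assms(2) by (simp add: norm_mult)
      moreover have "(cmod (u + of_real x * w))\<^sup>2
          = (cmod u)\<^sup>2 + 2 * Re (cnj u * w) * x + (cmod w)\<^sup>2 * x\<^sup>2" for u w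
        unfolding cmod_power2 by (simp add: power2_eq_square algebra_simps)
      moreover have "poly [:A, C, B:] x = A + C * x + B * x\<^sup>2" for A B C
        by (simp add: power2_eq_square algebra_simps)
      ultimately show ?thesis
        by (simp only: p_def mult.assoc)
    qed
    have expand: "poly (p U) x ^ n = (\<Sum>i\<le>2 * n. coeff (p U ^ n) i * x ^ i)"
      for U :: "complex^'d^'d"
    proof -
      have "degree (p U) \<le> 2"
        by (auto simp: p_def degree_pCons_eq_if)
      then have "degree (p U ^ n) \<le> 2 * n"
        using degree_power_le[of "p U" n] by (meson le_trans mult_le_mono1)
      then have "p U ^ n = (\<Sum>i\<le>2 * n. monom (coeff (p U ^ n) i) i)"
        by (simp add: poly_as_sum_of_monoms')
      then have "poly (p U ^ n) x = poly (\<Sum>i\<le>2 * n. monom (coeff (p U ^ n) i) i) x"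
        by simp
      then show ?thesis
        by (simp add: poly_sum poly_monom)
    qed
    have "poly P x = expectation (\<lambda>U. \<Sum>i\<le>2 * n. coeff (p U ^ n) i * x ^ i)"
      using int by (simp add: P_def poly_sum poly_monom)
    also have "\<dots> = (1 + x\<^sup>2) ^ n * moment k j n"
      using expectation_linear_form[OF assms, of j x n] by (simp only: eval expand)
    finally show ?thesis
      by (simp add: power2_eq_square mult.commute)
  qed
  \<comment> \<open>Real polynomials that agree at every point have equal coefficients.\<close>
  then have "P = smult (moment k j n) ([:1, 0, 1:] ^ n)"
    by (metis poly_eq_poly_eq_iff ext)
  then have "coeff P 2 = moment k j n * coeff ([:1, 0, 1:] ^ n) 2"
    by simp
  moreover have "coeff ([:1, 0, 1::real:] ^ n) 2 = of_nat n"
    using coeff_trinomial_power(3)[of 1 0 1 n] by simp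
  moreover have "coeff P 2 = expectation (\<lambda>U. coeff (p U ^ n) 2)"
    \<comment> \<open>For n = 0 the sum defining P stops before index 2, and both sides are
      0.\<close>
    by (cases n) (simp_all add: P_def coeff_sum numeral_2_eq_2)
  ultimately show ?thesis
    by (simp add: p_def mult.commute)
qed

lemma mixed_moment:
  assumes "k \<noteq> l" and "n > 0"
  shows "of_nat n * expectation (\<lambda>U. (cmod (U $ k $ j))\<^sup>2 ^ (n - 1) * (cmod (U $ l $ j))\<^sup>2)
    = moment k j n"
proof -
  define c where "c z U = coeff ([:(cmod (U $ k $ j))\<^sup>2,
      2 * Re (cnj (U $ k $ j) * (z * U $ l $ j)), (cmod (U $ l $ j))\<^sup>2:] ^ n) 2"
    for z and U :: "complex^'d^'d"
  have sum: "c 1 U + c \<i> U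
      = 2 * (of_nat n)\<^sup>2 * ((cmod (U $ k $ j))\<^sup>2 ^ (n - 1) * (cmod (U $ l $ j))\<^sup>2)"
    for U :: "complex^'d^'d"
  proof -
    define u v where "u = U $ k $ j" and "v = U $ l $ j"
    define A B where "A = (cmod u)\<^sup>2" and "B = (cmod v)\<^sup>2"
    \<comment> \<open>With w = \<open>cnj u * v\<close>, the two real parts are Re w and -Im w, so
      their squares add up to |w|^2 and the dependence on phases disappears.\<close>
    have "(2 * Re (cnj u * (1 * v)))\<^sup>2 + (2 * Re (cnj u * (\<i> * v)))\<^sup>2 = 4 * (A * B)"
      unfolding A_def B_def cmod_power2 by (simp add: power2_eq_square algebra_simps)
    moreover have "2 * (c 1 U + c \<i> U) = 4 * of_nat n * A ^ (n - 1) * B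
        + of_nat (n * (n - 1)) * A ^ (n - 2)
          * ((2 * Re (cnj u * (1 * v)))\<^sup>2 + (2 * Re (cnj u * (\<i> * v)))\<^sup>2)"
      unfolding c_def distrib_left coeff_trinomial_power(3)
      by (simp add: A_def B_def u_def v_def algebra_simps)
    ultimately have *: "2 * (c 1 U + c \<i> U) = 4 * of_nat n * A ^ (n - 1) * B
        + of_nat (n * (n - 1)) * A ^ (n - 2) * (4 * (A * B))"
      by simp
    obtain m where m: "n = Suc m"
      using assms(2) by (cases n) auto
    \<comment> \<open>The terms combine through n + n(n-1) = n^2. Merging
      \<open>A ^ (n - 2) * A\<close> into \<open>A ^ (n - 1)\<close> fails for n = 1, but there the
      factor n(n-1) is 0; hence the case split on m.\<close>
    have "c 1 U + c \<i> U = 2 * (of_nat n)\<^sup>2 * (A ^ (n - 1) * B)"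
      using * by (cases m) (simp_all add: m power2_eq_square algebra_simps)
    then show ?thesis
      by (simp add: A_def B_def u_def v_def)
  qed
  have cont: "continuous_on UNIV (c z)" for z
    unfolding c_def by (intro continuous_coeff_trinomial_power continuous_intros)
  have "expectation (c z) = of_nat n * moment k j n" if "cmod z = 1" for z
    unfolding c_def using expectation_coeff_trinomial[OF assms(1) that] .
  then have "expectation (\<lambda>U. c 1 U + c \<i> U) = 2 * (of_nat n * moment k j n)"
    using integrable_continuous[OF cont] by simp
  \<comment> \<open>The two evaluations give 2 n^2 E = 2 n T, with E the mixed expectation and T the
    moment; n > 0 permits cancelling 2n.\<close>
  then show ?thesis
    using assms(2) unfolding sum by (simp add: power2_eq_square)
qed

lemma moment_rec:
  "of_nat (CARD('d) + n) * moment k j (Suc n) = of_nat (Suc n) * moment k j n"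
proof -
  let ?f = "\<lambda>l U. (cmod (U $ k $ j))\<^sup>2 ^ n * (cmod (U $ l $ j))\<^sup>2"
  have "continuous_on UNIV (?f l)" for l
    by (intro continuous_intros)
  note int = integrable_continuous[OF this]
  \<comment> \<open>The integrand is multiplied by 1, written as the squared norm of column
    j.\<close>
  have "moment k j n = expectation (\<lambda>U. \<Sum>l\<in>UNIV. ?f l U)"
    unfolding moment_def
    by (intro Bochner_Integration.integral_cong refl)
      (simp add: space_haar unitary_column_norm flip: sum_distrib_left)
  also have "\<dots> = (\<Sum>l\<in>UNIV. expectation (?f l))"
    by (intro Bochner_Integration.integral_sum int)
  also have "\<dots> = expectation (?f k) + (\<Sum>l\<in>UNIV - {k}. expectation (?f l))"
    by (simp add: sum.remove)
  also have "expectation (?f k) = moment k j (Suc n)"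
    by (simp add: moment_def mult.commute)
  \<comment> \<open>All d - 1 off-diagonal terms have the same value by \<open>mixed_moment\<close>
    at exponent n + 1, so the moment of order n is 1 + (d-1)/(n+1) times the next one.\<close>
  also have "(\<Sum>l\<in>UNIV - {k}. expectation (?f l))
      = (\<Sum>l\<in>UNIV - {k}. moment k j (Suc n) / of_nat (Suc n))"
    using mixed_moment[of k _ "Suc n" j]
    by (intro sum.cong refl) (simp add: field_simps)
  also have "\<dots> = (of_nat CARD('d) - 1) * (moment k j (Suc n) / of_nat (Suc n))"
    by (simp add: of_nat_diff)
  finally show ?thesis
    by (simp add: field_simps)
qed

lemma moment_eq: "moment k j n = fact n / (\<Prod>i<n. real (CARD('d) + i))"
proof (induction n)
  case 0
  show ?case by (simp add: moment_def prob_space)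
next
  case (Suc n)
  have "moment k j (Suc n) = of_nat (Suc n) * moment k j n / real (CARD('d) + n)"
    using moment_rec[of n k j]
    by (intro eq_divide_imp) (simp_all add: mult.commute add_nonneg_eq_0_iff)
  then show ?case
    using Suc by (simp add: mult.commute)
qed

end

section \<open>The rising product as a binomial coefficient\<close>

lemma prod_rising_eq_binomial:
  "(\<Prod>k<n. real (Suc e + k)) = fact n * real ((e + n) choose n)"
proof (induction n)
  case (Suc n)
  \<comment> \<open>Absorption identity for binomial coefficients; it supplies the new factor e + n
    + 1 of the product.\<close>
  have "real (Suc n) * real ((e + Suc n) choose Suc n) = real (Suc e + n) * real ((e + n) choose n)"
    by (metis Suc_times_binomial_eq add_Suc add_Suc_right mult.commute of_nat_mult)
  moreover have "(\<Prod>k<Suc n. real (Suc e + k))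
      = fact n * (real (Suc e + n) * real ((e + n) choose n))"
    using Suc by (simp del: of_nat_add)
  ultimately show ?case
    by (simp del: of_nat_add of_nat_Suc binomial_Suc_Suc add: mult.assoc mult.left_commute)
qed simp

theorem corollary1p2:
  fixes M :: "(complex^'d::finite^'d) measure" and i j :: 'd and n :: nat
  assumes "normalized_haar_measure M" and "n > 0"
  shows "prob_space.expectation M (\<lambda>U. cmod (U $ i $ j) ^ (2 * n))
           = fact n / (\<Prod>k<n. real (CARD('d) + k))
       \<and> fact n / (\<Prod>k<n. real (CARD('d) + k))
           = inverse (real ((CARD('d) + n - 1) choose n))"
proof
  interpret haar_unitary M
    by unfold_locales (fact assms(1))
  show "expectation (\<lambda>U. cmod (U $ i $ j) ^ (2 * n)) = fact n / (\<Prod>k<n. real (CARD('d) + k))"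
    using moment_eq[of i j n] by (simp add: moment_def power_mult)
  \<comment> \<open>Writing d = e + 1 turns the truncated subtraction d + n - 1 into e + n.\<close>
  obtain e where "CARD('d) = Suc e"
    using zero_less_card_finite[where 'a = 'd] gr0_conv_Suc by blast
  then show "fact n / (\<Prod>k<n. real (CARD('d) + k))
      = inverse (real ((CARD('d) + n - 1) choose n))"
    using prod_rising_eq_binomial[of e n] by (simp add: field_simps)
qed

end
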